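(* Assume the setting described in the context. For every $v\in\{0,\dots,\tau-1\}$ the digits satisfy $d_{v,0}=s_v$, $b_{v,0}=r_{v-1}$, and for every integer $u\ge1$, $$d_{v,u}\equiv \left[l^{e_v}\right]^{-1}\left(d_{v+1,u-1}-b_{v+u,u-1}\right)\pmod{m^{f_{v+u}}},$$ $$b_{v,u}\equiv \left[-m^{f_{v-1}}\right]^{-1}\left(d_{v-u,u-1}-b_{v-1,u-1}\right)\pmod{l^{e_{v-u-1}}},$$ where $[x]^{-1}$ denotes the inverse of $x$ modulo the indicated modulus.
   Context: Setting. Let $m,l\ge 2$ be coprime integers and $\tau\ge1$ an integer. Let $f_0,\dots,f_{\tau-1}$ be positive integers. Let $(a_{v,i})$, $v\in\{0,\dots,\tau-1\}$, $i\in\{0,\dots,l-1\}$, be integers with $a_{v,0}=0$ and, for $i\neq0$: $a_{v,i}\equiv -m^{f_v}i \pmod l$, $a_{v,i}\not\equiv0\pmod m$ and $a_{v,i}\not\equiv 0\pmod l$. For each $v\in\{0,\dots,\tau-1\}$ fix an admissible choice: an index $i_v\in\{1,\dots,l-1\}$, with $a_v:=a_{v,i_v}$; an integer $s_v$ with $1\le s_v\le m^{f_v}-1$ and $\gcd(s_v,m)=1$; and positive integers $e_v,r_v$ with $r_v\equiv i_v\pmod l$, $l^{e_v}s_v=m^{f_v}r_v+a_v$, and $|a_v|<\max(m^{f_v},l^{e_v})$. All indexed quantities are extended $\tau$-periodically to all integer indices. Iterates. Let $\mathbb Z_{\langle m,l\rangle}$ be the subring of $\mathbb Q$ of fractions whose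 denominators are coprime to both $m$ and $l$. Let $(n_v)_{v\in\mathbb Z}$ be a $\tau$-periodic sequence in $\mathbb Z_{\langle m,l\rangle}$ with $n_v\equiv s_v\pmod{m^{f_v}}$ and $n_{v+1}=l^{e_v}\frac{n_v-s_v}{m^{f_v}}+r_v$ for all $v$. Graded digits. $k_{v,0}=n_v$, $k_{v,u}=m^{f_{v+u}}k_{v,u+1}+d_{v,u}$ with $d_{v,u}\in\{0,\dots,m^{f_{v+u}}-1\}$, $k_{v,u+1}\in\mathbb Z_{\langle m,l\rangle}$ (so $d_{v,u}$ is the $u$-th digit of $n_v$ in the graded $m$-adic expansion $n_v=\sum_{u\ge0}d_{v,u}m^{f_v+\dots+f_{v+u-1}}$); $j_{v,0}=n_v$, $j_{v,u}=l^{e_{v-1-u}}j_{v,u+1}+b_{v,u}$ with $b_{v,u}\in\{0,\dots,l^{e_{v-1-u}}-1\}$, $j_{v,u+1}\in\mathbb Z_{\langle m,l\rangle}$ (so $b_{v,u}$ is the $u$-th digit of $n_v$ in the graded $l$-adic expansion $n_v=\sum_{u\ge0}b_{v,u}l^{e_{v-1}+\dots+e_{v-u}}$). Digit indices in the first subscript are taken modulo $\tau$. *)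

theory Defs
  imports "HOL-Number_Theory.Number_Theory" "HOL-Library.Periodic_Fun"
begin

definition loc_ring :: "int \<Rightarrow> int \<Rightarrow> rat set" where
  "loc_ring m l = {rat_of_int p / rat_of_int q | p q. q \<noteq> 0 \<and> coprime q m \<and> coprime q l}"

text \<open>
  Congruence in the ring \<^term>\<open>loc_ring m l\<close> modulo the principal ideal generated by \<open>N\<close>.
  Over \<^typ>\<open>rat\<close>, the library's \<^const>\<open>cong\<close> does not express this.
\<close>

definition loc_cong :: "int \<Rightarrow> int \<Rightarrow> rat \<Rightarrow> rat \<Rightarrow> rat \<Rightarrow> bool" where
  "loc_cong m l x y N \<longleftrightarrow> (\<exists>t \<in> loc_ring m l. x - y = N * t)"

end

theory Submission
  imports Defs
begin

text \<open>
  The scaled tails of the two expansions agree along diagonals: $k_{v,u} = j_{v+u,u}$.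
  Indeed $k_{v+1,u} - l^{e_v} k_{v,u+1}$ is the carry of a long division: it starts at
  $r_v \in [0, l^{e_v})$, it is an integer, and it stays in that interval, so it is the
  $l$-adic digit $b_{v+u+1,u}$ of $j_{v+u+1,u} = k_{v+1,u}$. The recursion for the carry is the
  exact identity
  $b_{v+u,u-1} = m^{f_{v+u}} b_{v+u+1,u} + d_{v+1,u-1} - l^{e_v} d_{v,u}$,
  and reducing it modulo $m^{f_{v+u}}$ and, after a shift of $v$, modulo $l^{e_v}$ gives the
  two congruences.
\<close>

section \<open>Divisibility and remainders in the localized ring\<close>

lemma loc_ring_commute: "loc_ring m l = loc_ring l m"
  unfolding loc_ring_def by blast

lemma loc_ring_add:
  assumes "x \<in> loc_ring m l" "y \<in> loc_ring m l"
  shows "x + y \<in> loc_ring m l"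
proof -
  obtain p q where x: "x = of_int p / of_int q" "q \<noteq> 0" "coprime q m" "coprime q l"
    using assms(1) unfolding loc_ring_def by blast
  obtain p' q' where y: "y = of_int p' / of_int q'" "q' \<noteq> 0" "coprime q' m" "coprime q' l"
    using assms(2) unfolding loc_ring_def by blast
  have "x + y = of_int (p * q' + p' * q) / of_int (q * q')"
    using x y by (simp add: field_simps)
  moreover have "q * q' \<noteq> 0" "coprime (q * q') m" "coprime (q * q') l"
    using x y by auto
  ultimately show ?thesis unfolding loc_ring_def by blast
qed

lemma loc_ring_of_int_mult:
  assumes "x \<in> loc_ring m l"
  shows "of_int c * x \<in> loc_ring m l"
proof -
  obtain p q where x: "x = of_int p / of_int q" "q \<noteq> 0" "coprime q m" "coprime q l"
    using assms unfolding loc_ring_def by blast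
  have "of_int c * x = of_int (c * p) / of_int q"
    using x by simp
  then show ?thesis using x unfolding loc_ring_def by blast
qed

lemma loc_ring_diff:
  assumes "x \<in> loc_ring m l" "y \<in> loc_ring m l"
  shows "x - y \<in> loc_ring m l"
  using loc_ring_add[OF assms(1) loc_ring_of_int_mult[OF assms(2), of "-1"]] by simp

text \<open>Clearing a denominator coprime to \<open>m\<close> does not affect divisibility by
  powers of \<open>m\<close>. Swapping \<open>m\<close> and \<open>l\<close> by
  \<open>loc_ring_commute\<close> gives the same for \<open>l\<close>.\<close>

lemma loc_ring_power_dvd:
  assumes t: "t \<in> loc_ring m l" and eq: "of_int z = of_int (m ^ x) * t"
  shows "m ^ x dvd z"
proof -
  obtain p q where t': "t = of_int p / of_int q" "q \<noteq> 0" "coprime q m"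
    using t unfolding loc_ring_def by blast
  have "rat_of_int (z * q) = of_int (m ^ x * p)"
    using eq t' by (simp add: field_simps)
  then have "z * q = m ^ x * p" by (simp only: of_int_eq_iff)
  then have "m ^ x dvd z * q" by simp
  moreover have "coprime (m ^ x) q" using t'(3) by (simp add: coprime_commute)
  ultimately show ?thesis by (simp add: coprime_dvd_mult_left_iff)
qed

lemma loc_ring_digit_unique:
  assumes "t \<in> loc_ring m l" "t' \<in> loc_ring m l"
    and "of_int (m ^ x) * t + of_int c = of_int (m ^ x) * t' + of_int c'"
    and "0 \<le> c" "c < m ^ x" "0 \<le> c'" "c' < m ^ x"
  shows "c = c'"
proof -
  have "of_int (c - c') = of_int (m ^ x) * (t' - t)"
    using assms(3) by (simp add: algebra_simps)
  then have "m ^ x dvd c - c'"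
    by (rule loc_ring_power_dvd[OF loc_ring_diff[OF assms(2,1)]])
  then have "c mod m ^ x = c' mod m ^ x" by (simp add: mod_eq_dvd_iff)
  then show ?thesis using assms(4-7) by simp
qed

section \<open>Periodicity, solving linear congruences, and the size of the residues\<close>

lemma periodic_fun_simple_mod:
  fixes g :: "int \<Rightarrow> 'a"
  assumes "periodic_fun_simple g \<tau>"
  shows "g (v mod \<tau> + x) = g (v + x)"
proof -
  interpret periodic_fun_simple g \<tau> by fact
  have "g (v mod \<tau> + x + of_int (v div \<tau>) * \<tau>) = g (v mod \<tau> + x)"
    by (rule plus_of_int)
  moreover have "v mod \<tau> + x + of_int (v div \<tau>) * \<tau> = v + x"
    using mod_div_mult_eq[of v \<tau>] by simp
  ultimately show ?thesis by simp
qed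

lemma cong_modular_inverse_multI:
  fixes x y c q :: int
  assumes "coprime c q" "[c * x = y] (mod q)"
  shows "[x = modular_inverse q c * y] (mod q)"
proof -
  have "[modular_inverse q c * c * x = 1 * x] (mod q)"
    using assms(1) by (intro cong_scalar_right cong_modular_inverse2)
  moreover have "[modular_inverse q c * (c * x) = modular_inverse q c * y] (mod q)"
    using assms(2) by (rule cong_scalar_left)
  ultimately show ?thesis
    by (metis cong_sym cong_trans mult.assoc mult_1)
qed

text \<open>Since \<open>l\<close> divides \<open>l ^ e\<close> but not \<open>r\<close>, failure of
  the bound means \<open>r \<ge> l ^ e + 1\<close>. Then
  \<open>- a = M * r - l ^ e * s \<ge> M + l ^ e\<close>, which exceeds the maximum bounding
  \<open>\<bar>a\<bar>\<close>. This makes \<open>r\<close> a legitimate digit to base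
  \<open>l ^ e\<close>.\<close>

lemma admissible_residue_bound:
  fixes M L s r a :: int
  assumes "l ^ e * s = M * r + a" "\<bar>a\<bar> < max M (l ^ e)" "s \<le> M - 1"
    and "M > 0" "l > 0" "e > 0" "\<not> l dvd r"
  shows "r < l ^ e"
proof (rule ccontr)
  assume "\<not> r < l ^ e"
  moreover have "r \<noteq> l ^ e" using assms(6,7) by (auto simp: dvd_power)
  ultimately have "r \<ge> l ^ e + 1" by simp
  then have "M * r \<ge> M * l ^ e + M"
    using mult_left_mono[of "l ^ e + 1" r M] assms(4) by (simp add: algebra_simps)
  moreover have "l ^ e * s \<le> l ^ e * M - l ^ e"
    using mult_left_mono[OF assms(3), of "l ^ e"] assms(5) by (simp add: algebra_simps)
  moreover have "l ^ e > 0" using assms(5) by simp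
  ultimately show False using assms(1,2,4) by (auto simp: max_def algebra_simps split: if_splits)
qed

text \<open>The admissible choice enters only through the ranges of \<open>s\<close> and
  \<open>r\<close>. All data live on the whole of the integers, so diagonals can be followed without
  reducing indices.\<close>

locale graded_expansions =
  fixes m l :: int and f e :: "int \<Rightarrow> nat" and s r :: "int \<Rightarrow> int"
    and n :: "int \<Rightarrow> rat" and k j :: "int \<Rightarrow> nat \<Rightarrow> rat" and d b :: "int \<Rightarrow> nat \<Rightarrow> int"
  assumes m: "m > 0" and l: "l > 0"
    and s: "0 \<le> s v" "s v < m ^ f v"
    and r: "0 \<le> r v" "r v < l ^ e v"
    and n_cong: "loc_cong m l (n v) (of_int (s v)) (of_int (m ^ f v))"
    and n_step: "n (v + 1) =
      of_int (l ^ e v) * ((n v - of_int (s v)) / of_int (m ^ f v)) + of_int (r v)"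
    and k_0: "k v 0 = n v"
    and k_step: "k v u = of_int (m ^ f (v + int u)) * k v (u + 1) + of_int (d v u)"
    and d_range: "0 \<le> d v u" "d v u < m ^ f (v + int u)"
    and k_loc: "k v (u + 1) \<in> loc_ring m l"
    and j_0: "j v 0 = n v"
    and j_step: "j v u = of_int (l ^ e (v - 1 - int u)) * j v (u + 1) + of_int (b v u)"
    and b_range: "0 \<le> b v u" "b v u < l ^ e (v - 1 - int u)"
    and j_loc: "j v (u + 1) \<in> loc_ring m l"
begin

section \<open>Leading digits, the carry, and the diagonal identity\<close>

lemma d_0: "d v 0 = s v"
proof -
  obtain t where t: "t \<in> loc_ring m l" "n v - of_int (s v) = of_int (m ^ f v) * t"
    using n_cong unfolding loc_cong_def by blast
  have "of_int (m ^ f v) * k v 1 + of_int (d v 0) = of_int (m ^ f v) * t + of_int (s v)"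
    using k_step[of v 0] k_0[of v] t(2) by (simp add: algebra_simps)
  then show ?thesis
    using loc_ring_digit_unique[of "k v 1" m l t] k_loc[of v 0] t(1) s[of v] d_range[of v 0] by simp
qed

text \<open>As \<open>s v\<close> is the zeroth digit, the quotient in the iteration is the tail
  \<open>k v 1\<close>. The iteration thus becomes a division by \<open>l ^ e v\<close> with
  remainder \<open>r v\<close>, the initial carry.\<close>

lemma n_Suc: "n (v + 1) = of_int (l ^ e v) * k v 1 + of_int (r v)"
proof -
  have "(n v - of_int (s v)) / of_int (m ^ f v) = k v 1"
    using k_step[of v 0] k_0[of v] d_0[of v] m by simp
  then show ?thesis using n_step[of v] by simp
qed

lemma b_0: "b (v + 1) 0 = r v"
proof -
  have "of_int (l ^ e v) * j (v + 1) 1 + of_int (b (v + 1) 0) =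
      of_int (l ^ e v) * k v 1 + of_int (r v)"
    using j_step[of "v + 1" 0] j_0[of "v + 1"] n_Suc[of v] by simp
  then show ?thesis
    using loc_ring_digit_unique[of "j (v + 1) 1" l m "k v 1" "e v" "b (v + 1) 0" "r v"]
      k_loc[of v 0] j_loc[of "v + 1" 0] r[of v] b_range[of "v + 1" 0]
    by (simp add: loc_ring_commute[of l m])
qed

text \<open>\<open>k (v + 1) u\<close> and \<open>k v (u + 1)\<close> are divided by the same power
  of \<open>m\<close>, so a relation between them with carry \<open>c\<close> passes to their tails
  with a new carry.\<close>

lemma carry_step:
  assumes eq: "k (v + 1) u = of_int (l ^ e v) * k v (u + 1) + of_int c"
    and c: "0 \<le> c" "c < l ^ e v"
  obtains c' where "k (v + 1) (u + 1) = of_int (l ^ e v) * k v (u + 2) + of_int c'"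
    "0 \<le> c'" "c' < l ^ e v"
    "c = m ^ f (v + 1 + int u) * c' + d (v + 1) u - l ^ e v * d v (u + 1)"
proof -
  define M where "M = m ^ f (v + 1 + int u)"
  define L where "L = l ^ e v"
  define w where "w = c + L * d v (u + 1) - d (v + 1) u"
  \<comment> \<open>\<open>t\<close> is the new carry, so far only a ring element; \<open>w\<close>
    is the integer \<open>M * t\<close>.\<close>
  define t where "t = k (v + 1) (u + 1) - of_int L * k v (u + 2)"
  have t: "t \<in> loc_ring m l"
    unfolding t_def using k_loc[of "v + 1" u] k_loc[of v "u + 1"]
    by (intro loc_ring_diff loc_ring_of_int_mult) simp_all
  have 1: "k (v + 1) u = of_int M * k (v + 1) (u + 1) + of_int (d (v + 1) u)"
    unfolding M_def by (rule k_step)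
  have 2: "k v (u + 1) = of_int M * k v (u + 2) + of_int (d v (u + 1))"
    using k_step[of v "u + 1"] by (simp add: M_def ac_simps)
  have 3: "k (v + 1) u = of_int L * k v (u + 1) + of_int c"
    using eq by (simp add: L_def)
  have w: "of_int w = of_int M * t"
    using 1 2 3 by (simp add: w_def t_def algebra_simps)
  then have "M dvd w"
    unfolding M_def by (rule loc_ring_power_dvd[OF t])
  then obtain c' where c': "w = M * c'" by blast
  have M: "M > 0" using m by (simp add: M_def)
  have L: "L > 0" using l by (simp add: L_def)
  have "0 \<le> d (v + 1) u" "d (v + 1) u < M"
    using d_range[of "v + 1" u] by (simp_all add: M_def)
  moreover have "0 \<le> d v (u + 1)" "d v (u + 1) + 1 \<le> M"
    using d_range[of v "u + 1"] by (simp_all add: M_def ac_simps)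
  then have "0 \<le> L * d v (u + 1)" "L * d v (u + 1) + L \<le> L * M"
    using L mult_left_mono[of "d v (u + 1) + 1" M L] by (simp_all add: algebra_simps)
  moreover have "0 \<le> c" "c < L" using c by (simp_all add: L_def)
  \<comment> \<open>Below, \<open>w \<ge> - d (v + 1) u > - M\<close>. Above, a digit of at most
    \<open>M - 1\<close> leaves room \<open>L\<close> for the carry \<open>c < L\<close>.
    Integrality of \<open>c'\<close> then sharpens \<open>- 1 < c'\<close> to
    \<open>0 \<le> c'\<close>.\<close>
  ultimately have "M * (- 1) < w" "w < M * L"
    by (simp_all add: w_def algebra_simps)
  then have "- 1 < c'" "c' < L"
    unfolding c' using M by (simp_all only: mult_less_cancel_left_pos)
  moreover have "t = of_int c'"
    using w M by (simp add: c')
  moreover have "c = M * c' + d (v + 1) u - L * d v (u + 1)"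
    using c' by (simp add: w_def)
  ultimately show thesis
    by (intro that[of c']) (simp_all add: t_def M_def L_def)
qed

text \<open>Each half feeds the other: equal remainders let the tails be identified at
  \<open>u + 1\<close>, and identified tails force the new carry to be the next
  \<open>l\<close>-adic digit. \<open>v\<close> is arbitrary because the step uses both
  \<open>v\<close> and \<open>v + 1\<close>.\<close>

lemma diagonal:
  "k v u = j (v + int u) u \<and>
   k (v + 1) u = of_int (l ^ e v) * k v (u + 1) + of_int (b (v + int u + 1) u)"
proof (induction u arbitrary: v)
  case 0
  show ?case using k_0 j_0 n_Suc[of v] b_0[of v] by simp
next
  case (Suc u)
  have diag: "k v (u + 1) = j (v + int u + 1) (u + 1)" for v
  proof -
    \<comment> \<open>The exponent index is \<open>(v + u + 1) - 1 - u = v\<close>, so this and the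
      hypothesis at \<open>v\<close> are divisions by the same \<open>l ^ e v\<close> with the same
      remainder.\<close>
    have "k (v + 1) u = of_int (l ^ e v) * j (v + int u + 1) (u + 1) + of_int (b (v + int u + 1) u)"
      using Suc[of "v + 1"] j_step[of "v + int u + 1" u] by (simp add: ac_simps)
    then show ?thesis using Suc[of v] l by simp
  qed
  have range: "0 \<le> b (v + int u + 1) u" "b (v + int u + 1) u < l ^ e v"
    using b_range[of "v + int u + 1" u] by simp_all
  obtain c' where c': "k (v + 1) (u + 1) = of_int (l ^ e v) * k v (u + 2) + of_int c'"
      "0 \<le> c'" "c' < l ^ e v"
    using carry_step[OF conjunct2[OF Suc[of v]] range] by blast
  have "k (v + 1) (u + 1) = of_int (l ^ e v) * j (v + int u + 2) (u + 2)
      + of_int (b (v + int u + 2) (u + 1))"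
    using diag[of "v + 1"] j_step[of "v + int u + 2" "u + 1"] by (simp add: ac_simps)
  then have "of_int (l ^ e v) * k v (u + 2) + of_int c' =
      of_int (l ^ e v) * j (v + int u + 2) (u + 2) + of_int (b (v + int u + 2) (u + 1))"
    using c'(1) by simp
  moreover have "k v (u + 2) \<in> loc_ring l m" "j (v + int u + 2) (u + 2) \<in> loc_ring l m"
    using k_loc[of v "u + 1"] j_loc[of "v + int u + 2" "u + 1"]
    by (simp_all add: loc_ring_commute[of l m])
  moreover have "0 \<le> b (v + int u + 2) (u + 1)" "b (v + int u + 2) (u + 1) < l ^ e v"
    using b_range[of "v + int u + 2" "u + 1"] by simp_all
  ultimately have "c' = b (v + int u + 2) (u + 1)"
    using c'(2,3) loc_ring_digit_unique by blast
  then show ?case using diag[of v] c'(1) by (simp add: ac_simps)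
qed

text \<open>The carry recursion with both carries named as digits. Starting at \<open>u\<close>
  instead of \<open>u - 1\<close> avoids truncated subtraction.\<close>

lemma digit_identity:
  "b (v + int u + 1) u =
   m ^ f (v + int u + 1) * b (v + int u + 2) (u + 1) + d (v + 1) u - l ^ e v * d v (u + 1)"
proof -
  have range: "0 \<le> b (v + int u + 1) u" "b (v + int u + 1) u < l ^ e v"
    using b_range[of "v + int u + 1" u] by simp_all
  obtain c' where c': "k (v + 1) (u + 1) = of_int (l ^ e v) * k v (u + 2) + of_int c'"
      "b (v + int u + 1) u = m ^ f (v + 1 + int u) * c' + d (v + 1) u - l ^ e v * d v (u + 1)"
    using carry_step[OF conjunct2[OF diagonal[of v u]] range] by blast
  have "c' = b (v + int u + 2) (u + 1)"
    using c'(1) diagonal[of v "u + 1"] by (simp add: ac_simps)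
  then show ?thesis using c'(2) by (simp add: ac_simps)
qed

lemma d_cong:
  assumes "coprime m l" "u \<ge> 1"
  shows "[d v u = modular_inverse (m ^ f (v + int u)) (l ^ e v)
           * (d (v + 1) (u - 1) - b (v + int u) (u - 1))] (mod m ^ f (v + int u))"
proof (rule cong_modular_inverse_multI)
  show "coprime (l ^ e v) (m ^ f (v + int u))"
    using assms(1) by (simp add: coprime_commute)
  have "int (u - 1) = int u - 1" using assms(2) by simp
  then have "l ^ e v * d v u - (d (v + 1) (u - 1) - b (v + int u) (u - 1)) =
      m ^ f (v + int u) * b (v + int u + 1) u"
    using digit_identity[of v "u - 1"] assms(2) by (simp add: algebra_simps)
  then show "[l ^ e v * d v u = d (v + 1) (u - 1) - b (v + int u) (u - 1)] (mod m ^ f (v + int u))"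
    by (simp add: cong_iff_dvd_diff)
qed

text \<open>Basing the identity at \<open>v - u - 1\<close> makes \<open>b v u\<close> the unknown,
  with coefficient \<open>m ^ f (v - 1)\<close>, and the term in \<open>d (v - u - 1) u\<close> a
  multiple of the modulus.\<close>

lemma b_cong:
  assumes "coprime m l" "u \<ge> 1"
  shows "[b v u = modular_inverse (l ^ e (v - int u - 1)) (- (m ^ f (v - 1)))
           * (d (v - int u) (u - 1) - b (v - 1) (u - 1))] (mod l ^ e (v - int u - 1))"
proof (rule cong_modular_inverse_multI)
  show "coprime (- (m ^ f (v - 1))) (l ^ e (v - int u - 1))"
    using assms(1) by simp
  have "int (u - 1) = int u - 1" using assms(2) by simp
  then have "- (m ^ f (v - 1)) * b v u - (d (v - int u) (u - 1) - b (v - 1) (u - 1)) =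
      l ^ e (v - int u - 1) * (- d (v - int u - 1) u)"
    using digit_identity[of "v - int u - 1" "u - 1"] assms(2) by (simp add: algebra_simps)
  then show "[- (m ^ f (v - 1)) * b v u = d (v - int u) (u - 1) - b (v - 1) (u - 1)]
      (mod l ^ e (v - int u - 1))"
    unfolding cong_iff_dvd_diff by (metis dvd_triv_left)
qed

end

section \<open>Transfer to indices modulo \<open>\<tau>\<close>\<close>

theorem theorem4p4:
  fixes m l \<tau> :: int
    and f e :: "int \<Rightarrow> nat"
    and a :: "int \<Rightarrow> int \<Rightarrow> int"
    and i s r :: "int \<Rightarrow> int"
    and n :: "int \<Rightarrow> rat"
    and k j :: "int \<Rightarrow> nat \<Rightarrow> rat"
    and d b :: "int \<Rightarrow> nat \<Rightarrow> int"
  assumes "m \<ge> 2" and "l \<ge> 2" and "coprime m l" and "\<tau> \<ge> 1"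
    \<comment> \<open>periodic extension of the data\<close>
    and "periodic_fun_simple f \<tau>" and "periodic_fun_simple e \<tau>"
    and "periodic_fun_simple i \<tau>" and "periodic_fun_simple s \<tau>"
    and "periodic_fun_simple r \<tau>" and "periodic_fun_simple n \<tau>"
    and "\<And>c. c \<in> {0..<l} \<Longrightarrow> periodic_fun_simple (\<lambda>v. a v c) \<tau>"
    and "\<And>v. v \<in> {0..<\<tau>} \<Longrightarrow> f v > 0"
    \<comment> \<open>the coefficients\<close>
    and "\<And>v. v \<in> {0..<\<tau>} \<Longrightarrow> a v 0 = 0"
    and "\<And>v c. v \<in> {0..<\<tau>} \<Longrightarrow> c \<in> {1..<l} \<Longrightarrow> [a v c = - (m ^ f v) * c] (mod l)"
    and "\<And>v c. v \<in> {0..<\<tau>} \<Longrightarrow> c \<in> {1..<l} \<Longrightarrow> \<not> [a v c = 0] (mod m)"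
    and "\<And>v c. v \<in> {0..<\<tau>} \<Longrightarrow> c \<in> {1..<l} \<Longrightarrow> \<not> [a v c = 0] (mod l)"
    \<comment> \<open>the admissible choice\<close>
    and "\<And>v. v \<in> {0..<\<tau>} \<Longrightarrow> i v \<in> {1..l - 1}"
    and "\<And>v. v \<in> {0..<\<tau>} \<Longrightarrow> 1 \<le> s v \<and> s v \<le> m ^ f v - 1"
    and "\<And>v. v \<in> {0..<\<tau>} \<Longrightarrow> gcd (s v) m = 1"
    and "\<And>v. v \<in> {0..<\<tau>} \<Longrightarrow> e v > 0"
    and "\<And>v. v \<in> {0..<\<tau>} \<Longrightarrow> r v > 0"
    and "\<And>v. v \<in> {0..<\<tau>} \<Longrightarrow> [r v = i v] (mod l)"
    and "\<And>v. v \<in> {0..<\<tau>} \<Longrightarrow> l ^ e v * s v = m ^ f v * r v + a v (i v)"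
    and "\<And>v. v \<in> {0..<\<tau>} \<Longrightarrow> \<bar>a v (i v)\<bar> < max (m ^ f v) (l ^ e v)"
    \<comment> \<open>the iterates\<close>
    and "\<And>v. n v \<in> loc_ring m l"
    and "\<And>v. loc_cong m l (n v) (of_int (s v)) (of_int (m ^ f v))"
    and "\<And>v. n (v + 1) = of_int (l ^ e v) * ((n v - of_int (s v)) / of_int (m ^ f v)) + of_int (r v)"
    \<comment> \<open>the graded m-adic digits\<close>
    and "\<And>v. v \<in> {0..<\<tau>} \<Longrightarrow> k v 0 = n v"
    and "\<And>v u. v \<in> {0..<\<tau>} \<Longrightarrow> k v u = of_int (m ^ f (v + int u)) * k v (u + 1) + of_int (d v u)"
    and "\<And>v u. v \<in> {0..<\<tau>} \<Longrightarrow> d v u \<in> {0..m ^ f (v + int u) - 1}"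
    and "\<And>v u. v \<in> {0..<\<tau>} \<Longrightarrow> k v (u + 1) \<in> loc_ring m l"
    \<comment> \<open>the graded l-adic digits\<close>
    and "\<And>v. v \<in> {0..<\<tau>} \<Longrightarrow> j v 0 = n v"
    and "\<And>v u. v \<in> {0..<\<tau>} \<Longrightarrow> j v u = of_int (l ^ e (v - 1 - int u)) * j v (u + 1) + of_int (b v u)"
    and "\<And>v u. v \<in> {0..<\<tau>} \<Longrightarrow> b v u \<in> {0..l ^ e (v - 1 - int u) - 1}"
    and "\<And>v u. v \<in> {0..<\<tau>} \<Longrightarrow> j v (u + 1) \<in> loc_ring m l"
  shows "\<forall>v \<in> {0..<\<tau>}.
           d v 0 = s v \<and> b v 0 = r (v - 1) \<and>
           (\<forall>u \<ge> 1.
              [d v u = modular_inverse (m ^ f (v + int u)) (l ^ e v)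
                       * (d ((v + 1) mod \<tau>) (u - 1) - b ((v + int u) mod \<tau>) (u - 1))]
                (mod m ^ f (v + int u)) \<and>
              [b v u = modular_inverse (l ^ e (v - int u - 1)) (- (m ^ f (v - 1)))
                       * (d ((v - int u) mod \<tau>) (u - 1) - b ((v - 1) mod \<tau>) (u - 1))]
                (mod l ^ e (v - int u - 1)))"
proof -
  have v_mod: "v mod \<tau> \<in> {0..<\<tau>}" for v
    using \<open>\<tau> \<ge> 1\<close> by simp
  note f = periodic_fun_simple_mod[OF assms(5)]
  note e = periodic_fun_simple_mod[OF assms(6)]
  have f0: "f (v mod \<tau>) = f v" for v using f[of v 0] by simp
  have e0: "e (v mod \<tau>) = e v" for v using e[of v 0] by simp
  have s0: "s (v mod \<tau>) = s v" for v
    using periodic_fun_simple_mod[OF assms(8), of v 0] by simp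
  have r0: "r (v mod \<tau>) = r v" for v
    using periodic_fun_simple_mod[OF assms(9), of v 0] by simp
  have n0: "n (v mod \<tau>) = n v" for v
    using periodic_fun_simple_mod[OF assms(10), of v 0] by simp
  have e': "e (v mod \<tau> - 1 - x) = e (v - 1 - x)" for v x
    using e[of v "- 1 - x"] by (simp add: algebra_simps)
  have r_less: "r v < l ^ e v" if v: "v \<in> {0..<\<tau>}" for v
  proof (rule admissible_residue_bound)
    show "l ^ e v * s v = m ^ f v * r v + a v (i v)" using assms(23)[OF v] .
    show "\<bar>a v (i v)\<bar> < max (m ^ f v) (l ^ e v)" using assms(24)[OF v] .
    show "s v \<le> m ^ f v - 1" using assms(18)[OF v] by simp
    show "m ^ f v > 0" "l > 0" "e v > 0" using assms(1,2) assms(20)[OF v] by simp_all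
    \<comment> \<open>\<open>i v\<close> lies strictly between 0 and \<open>l\<close>, so it is its
      own residue and is nonzero.\<close>
    have "r v mod l = i v"
      using assms(22)[OF v] assms(17)[OF v] by (simp add: cong_def)
    then show "\<not> l dvd r v"
      using assms(17)[OF v] by (auto simp: dvd_eq_mod_eq_0)
  qed
  \<comment> \<open>The expansions are constrained only for first index in one period; composing
    with \<open>v mod \<tau>\<close> extends them to all integers, and periodicity of
    \<open>f\<close>, \<open>e\<close>, \<open>s\<close>, \<open>r\<close>, \<open>n\<close>
    preserves every relation.\<close>
  interpret graded_expansions m l f e s r n "\<lambda>v. k (v mod \<tau>)" "\<lambda>v. j (v mod \<tau>)"
    "\<lambda>v. d (v mod \<tau>)" "\<lambda>v. b (v mod \<tau>)"
  proof
    show "m > 0" "l > 0" using assms(1,2) by simp_all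
  next
    fix v :: int and u :: nat
    show "0 \<le> s v" "s v < m ^ f v"
      using assms(18)[OF v_mod[of v]] unfolding s0 f0 by linarith+
    show "0 \<le> r v" "r v < l ^ e v"
      using assms(21)[OF v_mod[of v]] r_less[OF v_mod[of v]] by (simp_all add: r0 e0)
    show "loc_cong m l (n v) (of_int (s v)) (of_int (m ^ f v))" by (rule assms(26))
    show "n (v + 1) = of_int (l ^ e v) * ((n v - of_int (s v)) / of_int (m ^ f v)) + of_int (r v)"
      by (rule assms(27))
    show "k (v mod \<tau>) 0 = n v" using assms(28)[OF v_mod] by (simp add: n0)
    show "k (v mod \<tau>) u =
        of_int (m ^ f (v + int u)) * k (v mod \<tau>) (u + 1) + of_int (d (v mod \<tau>) u)"
      using assms(29)[OF v_mod, of v u] unfolding f .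
    show "0 \<le> d (v mod \<tau>) u" "d (v mod \<tau>) u < m ^ f (v + int u)"
      using assms(30)[OF v_mod, of v u] unfolding f by simp_all
    show "k (v mod \<tau>) (u + 1) \<in> loc_ring m l" by (rule assms(31)[OF v_mod])
    show "j (v mod \<tau>) 0 = n v" using assms(32)[OF v_mod] by (simp add: n0)
    show "j (v mod \<tau>) u =
        of_int (l ^ e (v - 1 - int u)) * j (v mod \<tau>) (u + 1) + of_int (b (v mod \<tau>) u)"
      using assms(33)[OF v_mod, of v u] unfolding e' .
    show "0 \<le> b (v mod \<tau>) u" "b (v mod \<tau>) u < l ^ e (v - 1 - int u)"
      using assms(34)[OF v_mod, of v u] unfolding e' by simp_all
    show "j (v mod \<tau>) (u + 1) \<in> loc_ring m l" by (rule assms(35)[OF v_mod])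
  qed
  show ?thesis
  proof (intro ballI conjI allI impI)
    fix v assume v: "v \<in> {0..<\<tau>}"
    then have v': "v mod \<tau> = v" by simp
    show "d v 0 = s v" using d_0[of v] unfolding v' .
    show "b v 0 = r (v - 1)" using b_0[of "v - 1"] v' by simp
    fix u :: nat assume u: "u \<ge> 1"
    show "[d v u = modular_inverse (m ^ f (v + int u)) (l ^ e v)
            * (d ((v + 1) mod \<tau>) (u - 1) - b ((v + int u) mod \<tau>) (u - 1))] (mod m ^ f (v + int u))"
      using d_cong[OF assms(3) u, of v] unfolding v' .
    show "[b v u = modular_inverse (l ^ e (v - int u - 1)) (- (m ^ f (v - 1)))
            * (d ((v - int u) mod \<tau>) (u - 1) - b ((v - 1) mod \<tau>) (u - 1))]
          (mod l ^ e (v - int u - 1))"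
      using b_cong[OF assms(3) u, of v] unfolding v' .
  qed
qed

end
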